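(* Let $p$ be a prime. For any $r\in\mathbb{N}$ and $x\in\mathbb{Z}_p/p^r\mathbb{Z}_p$, we have $$\mathbf{1}_{x+p^r\mathbb{Z}_p}=\sum_{(m,n)\in S,\ n\le r}\frac{\overline{\big(\chi_{m,n}(1)\big)}^{\,x}}{p^r}\,\chi_{m,n}.$$
   Context: $\mathbb{Z}_p$ is the compact additive group of $p$-adic integers. Let $S=\{(1,0)\}\cup\{(m,n)\in\mathbb{N}\times\mathbb{N}: m<p^n,\ p\nmid m\}$. For $(m,n)\in S$, $\chi_{m,n}:\mathbb{Z}_p\to\mathbb{T}$ is the continuous character with $\chi_{m,n}(1)=e^{2\pi i m/p^n}$ (so $\chi_{1,0}$ is the trivial character); $(m,n)\mapsto\chi_{m,n}$ is a bijection from $S$ onto $\widehat{\mathbb{Z}_p}$. In the exponent, $x$ is taken to be the representative of the class $x$ in $\{0,1,\dots,p^r-1\}$. $\mathbf{1}_B$ denotes the characteristic function of $B\subseteq\mathbb{Z}_p$. *)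

theory Defs
  imports "HOL-Analysis.Analysis" "HOL-Algebra.Elementary_Groups" "HOL-Algebra.Product_Groups"
    "HOL-Computational_Algebra.Primes"
begin

text \<open>The additive group of \<open>p\<close>-adic integers, as the inverse limit of the groups
  \<open>\<int>/p\<^sup>n\<close>.  Addition is the multiplication of the monoid record: \<open>\<otimes>\<close> is
  \<open>p\<close>-adic addition, \<open>\<one>\<close> is the \<open>p\<close>-adic integer 0, and \<open>z [^] k\<close> is the multiple \<open>k z\<close>.\<close>

definition Zp :: "nat \<Rightarrow> (nat \<Rightarrow> int) monoid" where
  "Zp p = (let G = product_group UNIV (\<lambda>n. integer_mod_group (p ^ n))
           in G\<lparr>carrier := {z \<in> carrier G. \<forall>n. z (Suc n) mod int (p ^ n) = z n}\<rparr>)"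

definition Zp_topology :: "nat \<Rightarrow> (nat \<Rightarrow> int) topology" where
  "Zp_topology p =
     subtopology (product_topology (\<lambda>n. discrete_topology (carrier (integer_mod_group (p ^ n)))) UNIV)
       (carrier (Zp p))"

text \<open>The \<open>p\<close>-adic integer 1 (the component at \<open>n = 0\<close> lives in the trivial group and is 0).\<close>

definition Zp_unity :: "nat \<Rightarrow> nat \<Rightarrow> int" where
  "Zp_unity p = (\<lambda>n. 1 mod int (p ^ n))"

definition Zp_ppow :: "nat \<Rightarrow> nat \<Rightarrow> (nat \<Rightarrow> int) set" where
  "Zp_ppow p r = (\<lambda>z. z [^]\<^bsub>Zp p\<^esub> (p ^ r)) ` carrier (Zp p)"

text \<open>The representative in \<open>{0, \<dots>, p\<^sup>r - 1}\<close> of a class \<open>x\<close> modulo \<open>p\<^sup>r \<int>\<^sub>p\<close>.\<close>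

definition Zp_rep :: "nat \<Rightarrow> nat \<Rightarrow> (nat \<Rightarrow> int) set \<Rightarrow> nat" where
  "Zp_rep p r x = (THE k. k < p ^ r \<and> Zp_unity p [^]\<^bsub>Zp p\<^esub> k \<in> x)"

definition circle_group :: "complex monoid" where
  "circle_group = \<lparr>carrier = sphere 0 1, monoid.mult = (*), one = 1\<rparr>"

text \<open>Continuous characters are normalised to be \<open>undefined\<close> outside \<open>\<int>\<^sub>p\<close>, so that each of them
  is represented by exactly one function.\<close>

definition Zp_dual :: "nat \<Rightarrow> ((nat \<Rightarrow> int) \<Rightarrow> complex) set" where
  "Zp_dual p = {\<phi> \<in> extensional (carrier (Zp p)). \<phi> \<in> hom (Zp p) circle_group \<and>
     continuous_map (Zp_topology p) (top_of_set (sphere 0 1)) \<phi>}"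

definition char_index :: "nat \<Rightarrow> (nat \<times> nat) set" where
  "char_index p = {(1, 0)} \<union> {(m, n). m < p ^ n \<and> \<not> p dvd m}"

definition Zp_char :: "nat \<Rightarrow> nat \<Rightarrow> nat \<Rightarrow> (nat \<Rightarrow> int) \<Rightarrow> complex" where
  "Zp_char p m n =
     (THE \<phi>. \<phi> \<in> Zp_dual p \<and> \<phi> (Zp_unity p) = exp (2 * pi * \<i> * of_nat m / of_nat (p ^ n)))"

end

theory Submission imports Defs begin

text \<open>The character \<open>\<chi>\<^bsub>m,n\<^esub>\<close> sends \<open>z\<close> to \<open>exp (2\<pi>i m z\<^sub>n / p\<^sup>n)\<close>, where \<open>z\<^sub>n\<close> is the residue of
  \<open>z\<close> modulo \<open>p\<^sup>n\<close>; it is determined by its value at 1 because the multiples of 1 are dense.  Each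
  \<open>j \<in> {1, \<dots>, p\<^sup>r}\<close> is \<open>m p\<^bsup>r-n\<^esup>\<close> for exactly one index \<open>(m, n)\<close> with \<open>n \<le> r\<close>, so the right-hand
  side is the average of \<open>exp (2\<pi>i j (z\<^sub>r - x) / p\<^sup>r)\<close> over all \<open>j\<close>, a geometric sum that
  vanishes unless \<open>z\<^sub>r = x\<close>.\<close>

section \<open>Roots of unity\<close>

text \<open>Integer exponents allow residues of p-adic integers and their differences to be inserted
  directly; conjugation becomes negation.\<close>

definition unity_root :: "nat \<Rightarrow> int \<Rightarrow> complex" where
  "unity_root N k = cis (2 * pi * of_int k / of_nat N)"

lemma unity_root_0 [simp]: "unity_root N 0 = 1"
  by (simp add: unity_root_def)

lemma unity_root_add: "unity_root N (a + b) = unity_root N a * unity_root N b"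
  by (simp add: unity_root_def cis_mult add_divide_distrib distrib_left)

lemma unity_root_power: "unity_root N k ^ j = unity_root N (int j * k)"
  by (induction j) (simp_all add: unity_root_add distrib_right)

lemma cnj_unity_root: "cnj (unity_root N k) = unity_root N (- k)"
  by (simp add: unity_root_def cis_cnj)

lemma norm_unity_root [simp]: "norm (unity_root N k) = 1"
  by (simp add: unity_root_def)

text \<open>Serves to lift roots from the levels \<open>p ^ n\<close> to the common level
  \<open>p ^ r\<close>.\<close>

lemma unity_root_cancel: "c > 0 \<Longrightarrow> unity_root (c * N) (int c * k) = unity_root N k"
  by (simp add: unity_root_def mult.assoc)

lemma unity_root_eq_1_iff:
  assumes "N > 0"
  shows "unity_root N k = 1 \<longleftrightarrow> int N dvd k"
proof -
  have "unity_root N k = 1 \<longleftrightarrow> (\<exists>n::int. 2 * pi * of_int k / of_nat N = of_int (2 * n) * pi)"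
    unfolding unity_root_def cis_conv_exp exp_eq_1 by simp
  also have "\<dots> \<longleftrightarrow> (\<exists>n::int. k = int N * n)"
  proof (intro ex_cong1)
    fix n :: int
    have "2 * pi * of_int k / of_nat N = of_int (2 * n) * pi \<longleftrightarrow> real_of_int k = real_of_int (int N * n)"
      using assms by (auto simp: field_simps)
    then show "2 * pi * of_int k / of_nat N = of_int (2 * n) * pi \<longleftrightarrow> k = int N * n"
      by (simp only: of_int_eq_iff)
  qed
  finally show ?thesis
    by (auto simp: dvd_def)
qed

lemma unity_root_dvd_diff:
  assumes "N > 0" "int N dvd a - b"
  shows "unity_root N a = unity_root N b"
proof -
  have "unity_root N a = unity_root N (a - b) * unity_root N b"
    by (simp flip: unity_root_add)
  then show ?thesis
    using assms by (simp add: unity_root_eq_1_iff)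
qed

lemma sum_unity_root:
  assumes "N > 0"
  shows "(\<Sum>j=1..N. unity_root N (int j * d)) = (if int N dvd d then of_nat N else 0)"
proof (cases "int N dvd d")
  case True
  then have "unity_root N (int j * d) = 1" for j
    using assms by (simp add: unity_root_eq_1_iff)
  with True show ?thesis by simp
next
  case False
  let ?w = "unity_root N d"
  have w: "?w \<noteq> 1" "?w ^ N = 1"
    using False assms by (simp_all add: unity_root_eq_1_iff unity_root_power)
  have "(\<Sum>j=1..N. unity_root N (int j * d)) = (\<Sum>j=1..N. ?w ^ j)"
    by (simp add: unity_root_power)
  \<comment> \<open>Shifting the index pulls out one factor \<open>?w\<close> and leaves a full
    geometric sum, which vanishes because \<open>?w ^ N = 1\<close> while \<open>?w\<close> is not
    1.\<close>
  also have "\<dots> = (\<Sum>j<N. ?w * ?w ^ j)"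
    by (simp add: sum.atLeast1_atMost_eq)
  also have "\<dots> = 0"
    using w by (simp add: geometric_sum flip: sum_distrib_left)
  finally show ?thesis
    using False by simp
qed

section \<open>The group of p-adic integers\<close>

lemma carrier_Zp_iff:
  assumes "p > 0"
  shows "z \<in> carrier (Zp p) \<longleftrightarrow>
    (\<forall>n. 0 \<le> z n \<and> z n < int p ^ n \<and> z (Suc n) mod int p ^ n = z n)"
  using assms by (auto simp: Zp_def Let_def carrier_integer_mod_group PiE_iff)

lemma mult_Zp [simp]: "x \<otimes>\<^bsub>Zp p\<^esub> y = (\<lambda>n. (x n + y n) mod int p ^ n)"
  by (simp add: Zp_def Let_def fun_eq_iff)

lemma one_Zp [simp]: "\<one>\<^bsub>Zp p\<^esub> = (\<lambda>n. 0)"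
  by (simp add: Zp_def Let_def fun_eq_iff)

lemma pow_Zp: "z [^]\<^bsub>Zp p\<^esub> (k::nat) = (\<lambda>n. (int k * z n) mod int p ^ n)"
  by (induction k) (simp_all add: nat_pow_def fun_eq_iff distrib_right mod_add_left_eq add.commute mod_add_right_eq)

lemma Zp_mod:
  assumes "p > 0" "z \<in> carrier (Zp p)" "n \<le> k"
  shows "z k mod int p ^ n = z n"
  using \<open>n \<le> k\<close>
proof (induction k rule: dec_induct)
  case base
  then show ?case
    using assms by (simp add: carrier_Zp_iff)
next
  case (step k)
  have "z (Suc k) mod int p ^ n = z (Suc k) mod int p ^ k mod int p ^ n"
    using step by (simp add: mod_mod_cancel le_imp_power_dvd)
  also have "\<dots> = z k mod int p ^ n"
    using assms by (simp add: carrier_Zp_iff)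
  finally show ?case
    using step by simp
qed

lemma Zp_memI:
  assumes "p > 0" and "\<And>n. f (Suc n) mod int p ^ n = f n mod int p ^ n"
  shows "(\<lambda>n. f n mod int p ^ n) \<in> carrier (Zp p)"
proof -
  have "f (Suc n) mod int p ^ Suc n mod int p ^ n = f n mod int p ^ n" for n
    by (subst mod_mod_cancel) (simp_all add: assms)
  then show ?thesis
    using assms by (simp add: carrier_Zp_iff)
qed

text \<open>General integer coefficients cover sums, differences and integer multiples at
  once.\<close>

lemma Zp_lin_comb_closed:
  assumes "p > 0" "x \<in> carrier (Zp p)" "y \<in> carrier (Zp p)"
  shows "(\<lambda>n. (a * x n + b * y n) mod int p ^ n) \<in> carrier (Zp p)"
proof (rule Zp_memI)
  fix n
  have *: "x (Suc n) mod int p ^ n = x n mod int p ^ n" "y (Suc n) mod int p ^ n = y n mod int p ^ n"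
    using assms by (simp_all add: carrier_Zp_iff)
  show "(a * x (Suc n) + b * y (Suc n)) mod int p ^ n = (a * x n + b * y n) mod int p ^ n"
    by (intro mod_add_cong mod_mult_cong * refl)
qed (fact assms)

lemma Zp_unity_closed: "p > 0 \<Longrightarrow> Zp_unity p \<in> carrier (Zp p)"
  unfolding Zp_unity_def of_nat_power by (rule Zp_memI) simp_all

lemma pow_Zp_unity: "Zp_unity p [^]\<^bsub>Zp p\<^esub> (k::nat) = (\<lambda>n. int k mod int p ^ n)"
  by (simp add: pow_Zp Zp_unity_def mod_mult_right_eq)

lemma pow_Zp_unity_closed: "p > 0 \<Longrightarrow> Zp_unity p [^]\<^bsub>Zp p\<^esub> (k::nat) \<in> carrier (Zp p)"
  unfolding pow_Zp_unity by (rule Zp_memI) simp_all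

lemma Zp_ppow_eq:
  assumes "p > 0"
  shows "Zp_ppow p r = {z \<in> carrier (Zp p). z r = 0}"
proof (intro equalityI subsetI)
  fix z assume "z \<in> Zp_ppow p r"
  then obtain w where w: "w \<in> carrier (Zp p)" "z = w [^]\<^bsub>Zp p\<^esub> (p ^ r)"
    by (auto simp: Zp_ppow_def)
  then have "z = (\<lambda>n. (int (p ^ r) * w n + 0 * w n) mod int p ^ n)"
    by (simp add: pow_Zp)
  then show "z \<in> {z \<in> carrier (Zp p). z r = 0}"
    using Zp_lin_comb_closed[OF assms w(1) w(1), of "int (p ^ r)" 0] by simp
next
  fix z assume "z \<in> {z \<in> carrier (Zp p). z r = 0}"
  then have z: "z \<in> carrier (Zp p)" "z r = 0" by auto
  \<comment> \<open>Dividing by \<open>p ^ r\<close> costs r digits of precision, so component n of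
    the quotient is read off from component \<open>n + r\<close> of \<open>z\<close>; the division
    is exact because \<open>z r = 0\<close>.\<close>
  define w where "w = (\<lambda>n. z (n + r) div int p ^ r)"
  have *: "z k mod int p ^ r = 0" if "r \<le> k" for k
    using Zp_mod[OF assms z(1) that] z by simp
  have zw: "int p ^ r * w n = z (n + r)" for n
    using *[of "n + r"] by (simp add: w_def dvd_eq_mod_eq_0)
  have "w \<in> carrier (Zp p)"
    unfolding carrier_Zp_iff[OF assms]
  proof (intro allI conjI)
    fix n
    have zn: "0 \<le> z (n + r)" "z (n + r) < int p ^ (n + r)" "z (Suc n + r) mod int p ^ (n + r) = z (n + r)"
      using z by (simp_all add: carrier_Zp_iff[OF assms])
    show "0 \<le> w n"
      using zn by (simp add: w_def pos_imp_zdiv_nonneg_iff assms)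
    have "int p ^ r * w n < int p ^ r * int p ^ n"
      using zn(2) by (simp only: zw power_add mult.commute[of "int p ^ n"])
    then show "w n < int p ^ n"
      using assms by simp
    have "int p ^ r * (w (Suc n) mod int p ^ n) = int p ^ r * w n"
      using zn(3) by (simp only: mult_mod_right zw power_add mult.commute[of "int p ^ n"])
    then show "w (Suc n) mod int p ^ n = w n"
      using assms by simp
  qed
  moreover have "w [^]\<^bsub>Zp p\<^esub> (p ^ r) = z"
    using Zp_mod[OF assms z(1)] by (simp add: pow_Zp zw fun_eq_iff)
  ultimately show "z \<in> Zp_ppow p r"
    unfolding Zp_ppow_def by (metis image_eqI)
qed

text \<open>By \<open>Zp_ppow_eq\<close>, two elements share a coset exactly when their difference
  vanishes at component r.\<close>

lemma Zp_coset_eq: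
  assumes "p > 0" "g \<in> carrier (Zp p)"
  shows "Zp_ppow p r #>\<^bsub>Zp p\<^esub> g = {z \<in> carrier (Zp p). z r = g r}"
proof (intro equalityI subsetI)
  fix z assume "z \<in> Zp_ppow p r #>\<^bsub>Zp p\<^esub> g"
  then obtain h where "h \<in> carrier (Zp p)" "h r = 0" "z = h \<otimes>\<^bsub>Zp p\<^esub> g"
    unfolding r_coset_def Zp_ppow_eq[OF assms(1)] by auto
  then show "z \<in> {z \<in> carrier (Zp p). z r = g r}"
    using Zp_lin_comb_closed[OF assms(1) _ assms(2), of h 1 1] Zp_mod[OF assms, of r r] by simp
next
  fix z assume "z \<in> {z \<in> carrier (Zp p). z r = g r}"
  then have z: "z \<in> carrier (Zp p)" "z r = g r" by auto
  \<comment> \<open>The difference of \<open>z\<close> and \<open>g\<close>, in the form that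
    \<open>Zp_lin_comb_closed\<close> expects.\<close>
  define h where "h = (\<lambda>n. (1 * z n + (-1) * g n) mod int p ^ n)"
  have "h \<in> carrier (Zp p)" "h r = 0"
    using Zp_lin_comb_closed[OF assms(1) z(1) assms(2), of 1 "-1"] z by (simp_all add: h_def)
  moreover have "z = h \<otimes>\<^bsub>Zp p\<^esub> g"
    using Zp_mod[OF assms(1) z(1)] by (simp add: h_def fun_eq_iff mod_add_left_eq)
  ultimately show "z \<in> Zp_ppow p r #>\<^bsub>Zp p\<^esub> g"
    unfolding r_coset_def Zp_ppow_eq[OF assms(1)] by blast
qed

text \<open>The k-fold multiple of 1 has component \<open>k mod p ^ r\<close> at r, and this is k
  itself for \<open>k < p ^ r\<close>; so only \<open>k = g r\<close> qualifies.\<close>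

lemma Zp_rep_coset:
  assumes "p > 0" "g \<in> carrier (Zp p)"
  shows "int (Zp_rep p r {z \<in> carrier (Zp p). z r = g r}) = g r"
proof -
  have g: "0 \<le> g r" "g r < int p ^ r"
    using assms by (simp_all add: carrier_Zp_iff)
  have "Zp_rep p r {z \<in> carrier (Zp p). z r = g r} = nat (g r)"
    unfolding Zp_rep_def
  proof (rule the_equality)
    show "nat (g r) < p ^ r \<and> Zp_unity p [^]\<^bsub>Zp p\<^esub> nat (g r) \<in> {z \<in> carrier (Zp p). z r = g r}"
      using g pow_Zp_unity_closed[OF assms(1), of "nat (g r)"] by (simp add: nat_less_iff pow_Zp_unity)
  next
    fix k assume "k < p ^ r \<and> Zp_unity p [^]\<^bsub>Zp p\<^esub> k \<in> {z \<in> carrier (Zp p). z r = g r}"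
    then have "int k < int p ^ r" "int k mod int p ^ r = g r"
      by (simp_all add: pow_Zp_unity flip: of_nat_power)
    then show "k = nat (g r)" by simp
  qed
  then show ?thesis
    using g by simp
qed

section \<open>Characters\<close>

lemma topspace_Zp [simp]: "topspace (Zp_topology p) = carrier (Zp p)"
  by (auto simp: Zp_topology_def Zp_def Let_def)

lemma continuous_map_Zp_component:
  assumes "p > 0" and "\<And>z. z \<in> carrier (Zp p) \<Longrightarrow> f (z n) \<in> topspace Y"
  shows "continuous_map (Zp_topology p) Y (\<lambda>z. f (z n))"
proof -
  \<comment> \<open>\<open>f\<close> is known to map into \<open>Y\<close> only on residues that
    occur, hence the restriction to the image; on a discrete space continuity is then
    automatic.\<close>
  let ?U = "(\<lambda>z. z n) ` carrier (Zp p)"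
  let ?D = "discrete_topology (carrier (integer_mod_group (p ^ n)))"
  have "continuous_map (Zp_topology p) ?D (\<lambda>z. z n)"
    unfolding Zp_topology_def
    by (intro continuous_map_from_subtopology
        continuous_map_product_projection[where X = "\<lambda>n. discrete_topology (carrier (integer_mod_group (p ^ n)))"]) simp
  then have "continuous_map (Zp_topology p) (subtopology ?D ?U) (\<lambda>z. z n)"
    by (rule continuous_map_into_subtopology) simp
  moreover have "continuous_map (subtopology ?D ?U) Y f"
    using assms by (auto simp: subtopology_discrete_topology)
  ultimately show ?thesis
    using continuous_map_compose by (fastforce simp: o_def)
qed

text \<open>Density of the multiples of 1: the integer \<open>z k\<close> agrees with
  \<open>z\<close> in all components up to k, so every component is eventually constant.\<close>

lemma limitin_pow_Zp_unity:
  assumes "p > 0" "z \<in> carrier (Zp p)"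
  shows "limitin (Zp_topology p) (\<lambda>k. Zp_unity p [^]\<^bsub>Zp p\<^esub> nat (z k)) z sequentially"
proof -
  have pos: "z k \<ge> 0" for k
    using assms by (simp add: carrier_Zp_iff)
  have cl: "Zp_unity p [^]\<^bsub>Zp p\<^esub> nat (z k) \<in> carrier (Zp p)" for k
    using assms by (rule_tac pow_Zp_unity_closed)
  have sub: "carrier (Zp p) \<subseteq> (\<Pi>\<^sub>E n\<in>UNIV. carrier (integer_mod_group (p ^ n)))"
    by (auto simp: Zp_def Let_def)
  have "limitin (discrete_topology (carrier (integer_mod_group (p ^ n))))
          (\<lambda>k. (Zp_unity p [^]\<^bsub>Zp p\<^esub> nat (z k)) n) (z n) sequentially" for n
  proof (rule limitin_eventually)
    show "z n \<in> topspace (discrete_topology (carrier (integer_mod_group (p ^ n))))"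
      using sub assms by (auto simp: PiE_iff)
    show "\<forall>\<^sub>F k in sequentially. (Zp_unity p [^]\<^bsub>Zp p\<^esub> nat (z k)) n = z n"
      using eventually_ge_at_top[of n]
      by eventually_elim (simp add: pow_Zp_unity pos Zp_mod[OF assms])
  qed
  then show ?thesis
    unfolding Zp_topology_def limitin_subtopology limitin_componentwise
    using assms cl sub by (auto simp: PiE_iff subset_iff)
qed

lemma Zp_dual_pow_unity:
  assumes "p > 0" "\<phi> \<in> Zp_dual p"
  shows "\<phi> (Zp_unity p [^]\<^bsub>Zp p\<^esub> (k::nat)) = \<phi> (Zp_unity p) ^ k"
proof -
  have hom: "\<phi> \<in> hom (Zp p) circle_group"
    using assms by (simp add: Zp_dual_def)
  have one: "\<one>\<^bsub>Zp p\<^esub> \<in> carrier (Zp p)"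
    using assms by (simp add: carrier_Zp_iff)
  have nz: "norm (\<phi> \<one>\<^bsub>Zp p\<^esub>) = 1"
    using hom_in_carrier[OF hom one] by (simp add: circle_group_def)
  \<comment> \<open>Membership in \<open>hom\<close> gives only multiplicativity; the value at the
    identity is idempotent and nonzero, hence 1, which starts the induction.\<close>
  have "\<phi> \<one>\<^bsub>Zp p\<^esub> = \<phi> \<one>\<^bsub>Zp p\<^esub> * \<phi> \<one>\<^bsub>Zp p\<^esub>"
    using hom_mult[OF hom one one] by (simp add: circle_group_def)
  with nz have "\<phi> \<one>\<^bsub>Zp p\<^esub> = 1"
    by (metis mult_cancel_right1 norm_zero zero_neq_one)
  then show ?thesis
  proof (induction k)
    case (Suc k)
    have "\<phi> (Zp_unity p [^]\<^bsub>Zp p\<^esub> Suc k) = \<phi> (Zp_unity p [^]\<^bsub>Zp p\<^esub> k \<otimes>\<^bsub>Zp p\<^esub> Zp_unity p)"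
      by (simp only: nat_pow_Suc)
    also have "\<dots> = \<phi> (Zp_unity p [^]\<^bsub>Zp p\<^esub> k) * \<phi> (Zp_unity p)"
      using hom_mult[OF hom pow_Zp_unity_closed Zp_unity_closed] assms by (simp add: circle_group_def)
    finally show ?case
      using Suc by (simp add: mult.commute)
  qed (simp add: nat_pow_def)
qed

text \<open>On the carrier both values are limits of the same powers of the value at 1; outside it
  both functions are \<open>undefined\<close>.\<close>

lemma Zp_dual_eqI:
  assumes "p > 0" "\<phi> \<in> Zp_dual p" "\<psi> \<in> Zp_dual p" "\<phi> (Zp_unity p) = \<psi> (Zp_unity p)"
  shows "\<phi> = \<psi>"
proof (rule extensionalityI)
  show "\<phi> \<in> extensional (carrier (Zp p))" "\<psi> \<in> extensional (carrier (Zp p))"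
    using assms by (simp_all add: Zp_dual_def)
next
  fix z assume z: "z \<in> carrier (Zp p)"
  have lim: "(\<lambda>k. \<theta> (Zp_unity p) ^ nat (z k)) \<longlonglongrightarrow> \<theta> z" if "\<theta> \<in> Zp_dual p" for \<theta>
  proof -
    have "continuous_map (Zp_topology p) euclidean \<theta>"
      using that by (auto simp: Zp_dual_def intro: continuous_map_into_fulltopology)
    from continuous_map_limit[OF this limitin_pow_Zp_unity[OF assms(1) z]]
    show ?thesis
      by (simp add: o_def Zp_dual_pow_unity[OF assms(1) that])
  qed
  show "\<phi> z = \<psi> z"
    using lim[OF assms(2)] lim[OF assms(3)] assms(4) LIMSEQ_unique by auto
qed

text \<open>The explicit formula gives a member of the dual with the prescribed value at 1, and
  \<open>Zp_dual_eqI\<close> makes it the one selected by \<open>THE\<close>.\<close>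

lemma Zp_char_eq:
  assumes "p > 0" "z \<in> carrier (Zp p)"
  shows "Zp_char p m n z = unity_root (p ^ n) (int m * z n)"
proof -
  define \<phi> where "\<phi> = restrict (\<lambda>z. unity_root (p ^ n) (int m * z n)) (carrier (Zp p))"
  have "\<phi> \<in> hom (Zp p) circle_group"
  proof (rule homI)
    fix x y assume xy: "x \<in> carrier (Zp p)" "y \<in> carrier (Zp p)"
    have "int (p ^ n) dvd int m * ((x n + y n) mod int p ^ n) - (int m * x n + int m * y n)"
      by (simp add: mod_eq_dvd_iff[symmetric] mod_mult_right_eq flip: distrib_left)
    then show "\<phi> (x \<otimes>\<^bsub>Zp p\<^esub> y) = \<phi> x \<otimes>\<^bsub>circle_group\<^esub> \<phi> y"
      using xy assms Zp_lin_comb_closed[OF assms(1) xy, of 1 1] unity_root_dvd_diff[of "p ^ n"]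
      by (simp add: \<phi>_def circle_group_def flip: unity_root_add)
  qed (simp add: \<phi>_def circle_group_def)
  moreover have "continuous_map (Zp_topology p) (top_of_set (sphere 0 1)) \<phi>"
    using continuous_map_Zp_component[OF assms(1), of "\<lambda>k. unity_root (p ^ n) (int m * k)" n
        "top_of_set (sphere 0 1)"]
    by (rule continuous_map_eq) (simp_all add: \<phi>_def)
  ultimately have dual: "\<phi> \<in> Zp_dual p"
    by (simp add: Zp_dual_def \<phi>_def)
  \<comment> \<open>For \<open>n = 0\<close> the component of 1 is 0 rather than 1, so the exponents
    agree only modulo \<open>p ^ n\<close>.\<close>
  have "int (p ^ n) dvd int m * (1 mod int p ^ n) - int m"
    by (simp add: mod_eq_dvd_iff[symmetric] mod_mult_right_eq)
  then have "\<phi> (Zp_unity p) = unity_root (p ^ n) (int m)"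
    using unity_root_dvd_diff[of "p ^ n" "int m * (1 mod int p ^ n)" "int m"] assms Zp_unity_closed[OF assms(1)]
    by (simp add: \<phi>_def Zp_unity_def)
  also have "\<dots> = exp (2 * pi * \<i> * of_nat m / of_nat (p ^ n))"
    by (simp add: unity_root_def cis_conv_exp mult_ac)
  finally have "Zp_char p m n = \<phi>"
    unfolding Zp_char_def using dual Zp_dual_eqI[OF assms(1)] by (intro the_equality) auto
  then show ?thesis
    using assms by (simp add: \<phi>_def)
qed

section \<open>The expansion\<close>

text \<open>The range starts at 1 rather than 0 because the trivial character has the index \<open>(1, 0)\<close>.\<close>

lemma bij_betw_char_index:
  assumes "prime p"
  shows "bij_betw (\<lambda>(m, n). m * p ^ (r - n)) {(m, n) \<in> char_index p. n \<le> r} {1..p ^ r}"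
proof -
  have p: "p > 1"
    using assms by (rule prime_gt_1_nat)
  \<comment> \<open>Equality \<open>m = p ^ n\<close> occurs for the index \<open>(1, 0)\<close>,
    hence the weak bound.\<close>
  have ix: "\<not> p dvd m \<and> m \<le> p ^ n \<and> m > 0" if "(m, n) \<in> char_index p" for m n
    using that p by (auto simp: char_index_def intro: Nat.gr0I)
  show ?thesis
    unfolding bij_betw_def
  proof (intro conjI equalityI subsetI)
    show "inj_on (\<lambda>(m, n). m * p ^ (r - n)) {(m, n) \<in> char_index p. n \<le> r}"
    proof (rule inj_onI, clarify)
      fix m n m' n'
      assume mn: "(m, n) \<in> char_index p" "n \<le> r" and mn': "(m', n') \<in> char_index p" "n' \<le> r"
        and eq: "m * p ^ (r - n) = m' * p ^ (r - n')"
      \<comment> \<open>Since p does not divide m, the p-adic valuation of the image recovers n, and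
        cancelling the power of p then recovers m.\<close>
      have "multiplicity p (m * p ^ (r - n)) = r - n"
        using ix[OF mn(1)] p by (intro multiplicity_decomposeI[of _ _ _ m]) auto
      moreover have "multiplicity p (m * p ^ (r - n)) = r - n'"
        using ix[OF mn'(1)] p by (intro multiplicity_decomposeI[of _ _ _ m']) (auto simp: eq)
      ultimately have "n = n'"
        using mn mn' by simp
      then show "m = m' \<and> n = n'"
        using eq p by simp
    qed
  next
    fix j assume "j \<in> (\<lambda>(m, n). m * p ^ (r - n)) ` {(m, n) \<in> char_index p. n \<le> r}"
    then obtain m n where mn: "(m, n) \<in> char_index p" "n \<le> r" "j = m * p ^ (r - n)" by auto
    have "m * p ^ (r - n) \<le> p ^ n * p ^ (r - n)"
      using ix[OF mn(1)] by simp
    then show "j \<in> {1..p ^ r}"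
      using ix[OF mn(1)] mn p by (simp add: Suc_le_eq flip: power_add)
  next
    fix j assume j: "j \<in> {1..p ^ r}"
    define v where "v = multiplicity p j"
    obtain m where m: "j = p ^ v * m" "\<not> p dvd m"
      unfolding v_def using multiplicity_decompose'[of j p] j p by auto
    have "p ^ v dvd j" using m by simp
    then have "p ^ v \<le> p ^ r"
      using j by (auto dest: dvd_imp_le)
    then have v: "v \<le> r"
      using p by simp
    have "p ^ v * m \<le> p ^ v * p ^ (r - v)"
      using m j v by (simp flip: power_add)
    then have le: "m \<le> p ^ (r - v)"
      using p by simp
    have "(m, r - v) \<in> char_index p"
    \<comment> \<open>The boundary case is \<open>j = p ^ r\<close>: a power of p not divisible by p
      is 1, which gives the index \<open>(1, 0)\<close>.\<close>
    proof (cases "m = p ^ (r - v)")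
      case True
      with m(2) have "r - v = 0"
        by (cases "r - v") auto
      with True show ?thesis
        by (simp add: char_index_def)
    next
      case False
      with le m show ?thesis
        by (simp add: char_index_def)
    qed
    then show "j \<in> (\<lambda>(m, n). m * p ^ (r - n)) ` {(m, n) \<in> char_index p. n \<le> r}"
      using m v by (intro image_eqI[of _ _ "(m, r - v)"]) (simp_all add: mult.commute)
  qed
qed

theorem proposition4p2:
  fixes p r :: nat and x :: "(nat \<Rightarrow> int) set"
  assumes "prime p"
    and "x \<in> carrier (Zp p Mod Zp_ppow p r)"
  shows "\<forall>z \<in> carrier (Zp p).
    (indicator x z :: complex) =
      (\<Sum>(m, n) \<in> {(m, n) \<in> char_index p. n \<le> r}.
         cnj (Zp_char p m n (Zp_unity p)) ^ Zp_rep p r x / of_nat (p ^ r) * Zp_char p m n z)"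
proof
  fix z assume z: "z \<in> carrier (Zp p)"
  have p: "p > 0"
    using assms by (simp add: prime_gt_0_nat)
  obtain g where g: "g \<in> carrier (Zp p)" and x: "x = {z \<in> carrier (Zp p). z r = g r}"
    using assms(2) Zp_coset_eq[OF p] by (auto simp: FactGroup_def RCOSETS_def)
  define a where "a = Zp_rep p r x"
  have a: "int a = g r"
    unfolding a_def x by (rule Zp_rep_coset[OF p g])
  let ?S = "{(m, n) \<in> char_index p. n \<le> r}"
  let ?e = "\<lambda>j. unity_root (p ^ r) (int j * (z r - g r))"
  \<comment> \<open>Each summand depends on its index only through \<open>m * p ^ (r - n)\<close>,
    so the sum can be reindexed.\<close>
  have "cnj (Zp_char p m n (Zp_unity p)) ^ a / of_nat (p ^ r) * Zp_char p m n z
        = ?e (m * p ^ (r - n)) / of_nat (p ^ r)" if "n \<le> r" for m n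
  proof -
    have "cnj (Zp_char p m n (Zp_unity p)) ^ a * Zp_char p m n z
        = unity_root (p ^ n) (int m * z n - int a * (int m * (1 mod int p ^ n)))"
      using Zp_char_eq[OF p Zp_unity_closed[OF p], of m n]
      by (simp add: Zp_char_eq[OF p z] Zp_unity_def cnj_unity_root unity_root_power
          flip: unity_root_add)
    also have "\<dots> = unity_root (p ^ n) (int m * (z r - g r))"
    proof (rule unity_root_dvd_diff)
      \<comment> \<open>As \<open>n \<le> r\<close>, the components \<open>z n\<close> and
        \<open>z r\<close> agree modulo \<open>p ^ n\<close>.\<close>
      have "(int m * z n - int a * (int m * (1 mod int p ^ n))) mod int p ^ n
          = (int m * z r - int a * (int m * 1)) mod int p ^ n"
        by (intro mod_diff_cong mod_mult_cong) (simp_all add: Zp_mod[OF p z that, symmetric])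
      also have "int m * z r - int a * (int m * 1) = int m * (z r - g r)"
        by (simp add: a algebra_simps)
      finally show "int (p ^ n) dvd
          int m * z n - int a * (int m * (1 mod int p ^ n)) - int m * (z r - g r)"
        by (simp add: mod_eq_dvd_iff)
    qed (use p in simp)
    \<comment> \<open>Expanding the fraction in the exponent by \<open>p ^ (r - n)\<close> brings
      all levels to the denominator \<open>p ^ r\<close>.\<close>
    also have "\<dots> = unity_root (p ^ (r - n) * p ^ n) (int (p ^ (r - n)) * (int m * (z r - g r)))"
      using p by (intro unity_root_cancel[symmetric]) simp
    also have "\<dots> = ?e (m * p ^ (r - n))"
      using that by (simp add: mult_ac flip: power_add)
    finally show ?thesis by simp
  qed
  then have "(\<Sum>(m, n) \<in> ?S. cnj (Zp_char p m n (Zp_unity p)) ^ a / of_nat (p ^ r) * Zp_char p m n z)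
      = (\<Sum>(m, n) \<in> ?S. ?e (m * p ^ (r - n)) / of_nat (p ^ r))"
    by (intro sum.cong) auto
  also have "\<dots> = (\<Sum>j = 1..p ^ r. ?e j / of_nat (p ^ r))"
    using sum.reindex_bij_betw[OF bij_betw_char_index[OF assms(1)], of "\<lambda>j. ?e j / of_nat (p ^ r)" r]
    by (simp add: case_prod_unfold)
  also have "\<dots> = (if int (p ^ r) dvd z r - g r then 1 else 0)"
    using p sum_unity_root[of "p ^ r" "z r - g r"] by (simp flip: sum_divide_distrib)
  \<comment> \<open>Both components are already reduced modulo \<open>p ^ r\<close>, so congruence
    is equality.\<close>
  also have "int (p ^ r) dvd z r - g r \<longleftrightarrow> z r = g r"
    using Zp_mod[OF p z, of r r] Zp_mod[OF p g, of r r] by (simp flip: mod_eq_dvd_iff)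
  also have "(if z r = g r then 1 else 0) = (indicator x z :: complex)"
    using z by (simp add: x indicator_def)
  finally show "(indicator x z :: complex) =
      (\<Sum>(m, n) \<in> ?S. cnj (Zp_char p m n (Zp_unity p)) ^ Zp_rep p r x / of_nat (p ^ r) * Zp_char p m n z)"
    by (simp add: a_def)
qed

end
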